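(* There exists a deterministic nonincreasing sequence $\{\alpha_k\}_{k\ge 0}$ of positive reals with $\alpha_k=o(1/\log k)$ as $k\to\infty$ such that the random sequence $\{w_k\}_{k\ge0}\subset\mathbb{R}$ defined by $w_0=0$ and $w_{k+1}=w_k-\alpha_k\, g_{B_k}(w_k)$, where $B_0,B_1,\dots$ are independent and uniformly distributed on $\{\{1\},\{2\},\{1,2\}\}$ and $g_B$ is the minimum-norm selector defined in the context, satisfies $$|w_k|\le 1\ \text{ for all } k,\qquad \operatorname{Acc}(\{w_k\})=[-1,1]=\operatorname{crit}_J\ \text{ almost surely}.$$ Moreover, almost surely the sequence $\{w_k\}$ does not converge, even though $J$ is constant on its accumulation set.
   Context: Define functions on $\mathbb{R}$ by $\phi(x)=\max\{|x|-1,0\}$, $f_1(x)=\phi(x)+x$, $f_2(x)=\phi(x)-x$, and $J(x)=\frac12(f_1(x)+f_2(x))=\phi(x)$. Let $D_i=\partial_C f_i$ $(i=1,2)$ be the Clarke subdifferential (equal to the usual convex subdifferential, since $f_i$ is convex). Explicitly, on $[-1,1]$: $D_1(-1)=[0,1]$, $D_1(x)=\{1\}$ for $-1<x<1$, $D_1(1)=[1,2]$; $D_2(-1)=[-2,-1]$, $D_2(x)=\{-1\}$ for $-1<x<1$, $D_2(1)=[-1,0]$. For nonempty $B\subseteq\{1,2\}$, let $G_B(x)=\frac1{|B|}\sum_{i\in B}D_i(x)$ (Minkowski sum, a nonempty compact interval) and let $g_B(x)=\operatorname{proj}_{G_B(x)}(0)$ be the element of $G_B(x)$ of smallest absolute value.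 Let $D_J(x)=\frac12(D_1(x)+D_2(x))$ (Minkowski sum), which equals $\partial_C\phi(x)$, and $\operatorname{crit}_J=\{x\in\mathbb{R}:0\in D_J(x)\}$. For a real sequence $\{x_k\}$, $\operatorname{Acc}(\{x_k\})$ is the set of $x\in\mathbb{R}$ for which there are indices $k_j\uparrow\infty$ with $x_{k_j}\to x$. *)

theory Defs
  imports
    "HOL-Probability.Probability"
    "HOL-Library.Set_Algebras"
    "HOL-Library.Landau_Symbols"
begin

text \<open>Clarke's generalized directional derivative: the upper limit of the difference quotients
  as the base point tends to \<open>x\<close> (the value \<open>x\<close> itself being allowed) and the step tends to
  \<open>0\<close> from the right.\<close>

definition clarke_dderiv :: "('a::real_inner \<Rightarrow> real) \<Rightarrow> 'a \<Rightarrow> 'a \<Rightarrow> ereal" where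
  "clarke_dderiv f x v =
     Limsup (nhds x \<times>\<^sub>F at_right 0) (\<lambda>(y, t). ereal ((f (y + t *\<^sub>R v) - f y) / t))"

definition clarke_subdifferential :: "('a::real_inner \<Rightarrow> real) \<Rightarrow> 'a \<Rightarrow> 'a set" where
  "clarke_subdifferential f x = {\<xi>. \<forall>v. ereal (\<xi> \<bullet> v) \<le> clarke_dderiv f x v}"

definition phi :: "real \<Rightarrow> real" where
  "phi x = max (\<bar>x\<bar> - 1) 0"

definition f1 :: "real \<Rightarrow> real" where
  "f1 x = phi x + x"

definition f2 :: "real \<Rightarrow> real" where
  "f2 x = phi x - x"

definition J :: "real \<Rightarrow> real" where
  "J x = (f1 x + f2 x) / 2"

text \<open>Only the indices \<open>1\<close> and \<open>2\<close> are meaningful.\<close>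

definition D_comp :: "nat \<Rightarrow> real \<Rightarrow> real set" where
  "D_comp i = clarke_subdifferential (if i = 1 then f1 else f2)"

text \<open>Sums of sets are Minkowski sums.\<close>

definition G_batch :: "nat set \<Rightarrow> real \<Rightarrow> real set" where
  "G_batch B x = (\<lambda>d. 1 / real (card B) * d) ` (\<Sum>i\<in>B. D_comp i x)"

definition g_batch :: "nat set \<Rightarrow> real \<Rightarrow> real" where
  "g_batch B x = closest_point (G_batch B x) 0"

definition D_J :: "real \<Rightarrow> real set" where
  "D_J x = (\<lambda>d. 1 / 2 * d) ` (D_comp 1 x + D_comp 2 x)"

definition crit_J :: "real set" where
  "crit_J = {x. 0 \<in> D_J x}"

definition batches :: "nat set set" where
  "batches = {{1}, {2}, {1, 2}}"

primrec iterates :: "(nat \<Rightarrow> real) \<Rightarrow> (nat \<Rightarrow> nat set) \<Rightarrow> nat \<Rightarrow> real" where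
  "iterates \<alpha> b 0 = 0"
| "iterates \<alpha> b (Suc k) = iterates \<alpha> b k - \<alpha> k * g_batch (b k) (iterates \<alpha> b k)"

definition Acc :: "(nat \<Rightarrow> real) \<Rightarrow> real set" where
  "Acc u = {x. \<exists>r. strict_mono r \<and> (\<lambda>j. u (r j)) \<longlonglongrightarrow> x}"

end

theory Submission
  imports Defs "HOL-Real_Asymp.Real_Asymp"
begin

text \<open>With step sizes \<open>2\<^sup>-\<^sup>m\<close>, where \<open>m\<close> never decreases, the walk stays on dyadic grids and
  cannot jump over \<open>\<plusminus>1\<close>; there the minimum-norm selector vanishes or points inwards, so the iteration is
  a lazy symmetric walk clipped to \<open>[-1, 1]\<close>. For steps of order \<open>k\<^sup>-\<^sup>1\<^sup>/\<^sup>2\<close>, which is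
  \<open>o(1 / log k)\<close>, the squares are not summable, and a second-moment argument shows that
  both end points are visited infinitely often. As the increments tend to \<open>0\<close>, every point in between
  is an accumulation point.\<close>

section \<open>Clarke subdifferentials of piecewise linear functions and the minimum-norm
  selector\<close>

text \<open>Near \<open>x\<close>, \<open>f\<close> is a constant plus a sublinear function of
  \<open>y - x\<close>. Subadditivity bounds all nearby difference quotients, and the base point
  \<open>x\<close> itself attains the bound, so the Clarke derivative is the support function of
  \<open>{l..r}\<close>. The case \<open>l = r\<close> covers points of smoothness.\<close>

lemma clarke_subdifferential_kink:
  fixes f :: "real \<Rightarrow> real"
  assumes "0 < d" and "l \<le> r"
    and f: "\<And>y. \<bar>y - x\<bar> < d \<Longrightarrow> f y = f x + max (l * (y - x)) (r * (y - x))"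
  shows "clarke_subdifferential f x = {l..r}"
proof -
  let ?F = "nhds x \<times>\<^sub>F at_right (0::real)"
  let ?q = "\<lambda>v (y, t). ereal ((f (y + t *\<^sub>R v) - f y) / t)"
  define g where "g u = max (l * u) (r * u)" for u
  have le: "clarke_dderiv f x v \<le> ereal (max (l * v) (r * v))" for v
  proof -
    \<comment> \<open>Both \<open>y - x\<close> and \<open>t * v\<close> get half of the radius
      \<open>d\<close>, so that the formula for \<open>f\<close> applies at \<open>y\<close> and at
      \<open>y + t * v\<close>. Adding 1 to \<open>\<bar>v\<bar>\<close> avoids a zero denominator
      for \<open>v = 0\<close>.\<close>
    have quotient: "(f (y + t * v) - f y) / t \<le> max (l * v) (r * v)"
      if y: "\<bar>y - x\<bar> < d / 2" and t: "0 < t" "t < d / (2 * (\<bar>v\<bar> + 1))" for y t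
    proof -
      have "t * (\<bar>v\<bar> + 1) < d / 2" using t by (simp add: field_simps)
      moreover have "\<bar>t * v\<bar> \<le> t * (\<bar>v\<bar> + 1)" using t by (simp add: abs_mult algebra_simps)
      ultimately have "\<bar>t * v\<bar> < d / 2" by (rule le_less_trans[rotated])
      moreover have "\<bar>(y - x) + t * v\<bar> \<le> \<bar>y - x\<bar> + \<bar>t * v\<bar>"
        by (rule abs_triangle_ineq)
      ultimately have yt: "\<bar>y + t * v - x\<bar> < d" using y by (simp add: algebra_simps)
      have "g (y + t * v - x) \<le> g (y - x) + g (t * v)"
        by (simp add: g_def algebra_simps max_def)
      moreover have "g (t * v) = t * g v"
        using t by (simp add: g_def max_mult_distrib_left mult.left_commute)
      moreover have "f y = f x + g (y - x)"
        unfolding g_def by (rule f) (use y \<open>0 < d\<close> in simp)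
      ultimately have "f (y + t * v) - f y \<le> t * max (l * v) (r * v)"
        using f[OF yt] by (simp add: g_def[symmetric])
      then show "(f (y + t * v) - f y) / t \<le> max (l * v) (r * v)"
        using t by (simp add: field_simps)
    qed
    have "eventually (\<lambda>y. \<bar>y - x\<bar> < d / 2) (nhds x)"
      using eventually_nhds_metric[of _ x] \<open>0 < d\<close> by (auto simp: dist_real_def intro!: exI[of _ "d/2"])
    moreover have "eventually (\<lambda>t. 0 < t \<and> t < d / (2 * (\<bar>v\<bar> + 1))) (at_right (0::real))"
      using \<open>0 < d\<close> by (auto simp: eventually_at_right_field intro!: exI[of _ "d / (2 * (\<bar>v\<bar> + 1))"])
    ultimately have "eventually (\<lambda>p. \<bar>fst p - x\<bar> < d / 2 \<and> 0 < snd p \<and> snd p < d / (2 * (\<bar>v\<bar> + 1))) ?F"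
      by (rule eventually_prodI)
    then have "eventually (\<lambda>p. ?q v p \<le> ereal (max (l * v) (r * v))) ?F"
      by (rule eventually_mono) (use quotient in \<open>simp add: case_prod_beta del: le_max_iff_disj ereal_max\<close>)
    then show ?thesis
      unfolding clarke_dderiv_def by (intro Limsup_bounded)
  qed
  \<comment> \<open>The filter \<open>nhds x\<close> admits the base point \<open>y = x\<close>,
    where the quotient equals the bound for all small \<open>t\<close>; a strictly smaller upper
    limit is therefore impossible.\<close>
  have ge: "ereal (max (l * v) (r * v)) \<le> clarke_dderiv f x v" for v
  proof (rule ccontr)
    assume "\<not> ereal (max (l * v) (r * v)) \<le> clarke_dderiv f x v"
    then have "eventually (\<lambda>p. ?q v p < ereal (max (l * v) (r * v))) ?F"
      unfolding clarke_dderiv_def by (intro Limsup_lessD) (simp add: not_le del: ereal_max le_max_iff_disj)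
    then obtain P Q where P: "eventually P (nhds x)" and Q: "eventually Q (at_right (0::real))"
      and PQ: "\<And>y t. P y \<Longrightarrow> Q t \<Longrightarrow> ?q v (y, t) < ereal (max (l * v) (r * v))"
      unfolding eventually_prod_filter by blast
    have "eventually (\<lambda>t. 0 < t \<and> t < d / (\<bar>v\<bar> + 1)) (at_right (0::real))"
      using \<open>0 < d\<close> by (auto simp: eventually_at_right_field intro!: exI[of _ "d / (\<bar>v\<bar> + 1)"])
    with Q have "eventually (\<lambda>t. Q t \<and> 0 < t \<and> t < d / (\<bar>v\<bar> + 1)) (at_right (0::real))"
      by (rule eventually_conj)
    then obtain t where t: "Q t" "0 < t" "t < d / (\<bar>v\<bar> + 1)"
      using eventually_happens'[OF trivial_limit_at_right_real] by blast
    have "t * (\<bar>v\<bar> + 1) < d" using t by (simp add: field_simps)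
    moreover have "\<bar>t * v\<bar> \<le> t * (\<bar>v\<bar> + 1)" using t by (simp add: abs_mult algebra_simps)
    ultimately have "\<bar>x + t * v - x\<bar> < d" by simp
    from f[OF this] have "f (x + t * v) - f x = max (t * (l * v)) (t * (r * v))"
      by (simp add: mult.left_commute[of t])
    also have "\<dots> = t * max (l * v) (r * v)"
      using t by (simp add: max_mult_distrib_left)
    finally have "(f (x + t * v) - f x) / t = max (l * v) (r * v)"
      using t by simp
    then show False
      using PQ[OF eventually_nhds_x_imp_x[OF P] t(1)] by simp
  qed
  have "clarke_dderiv f x v = ereal (max (l * v) (r * v))" for v
    using le ge by (rule antisym)
  then have "clarke_subdifferential f x = {\<xi>. \<forall>v. \<xi> * v \<le> max (l * v) (r * v)}"
    by (simp add: clarke_subdifferential_def del: ereal_max)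
  also have "\<dots> = {l..r}"
  proof (intro set_eqI iffI)
    fix \<xi> assume "\<xi> \<in> {\<xi>. \<forall>v. \<xi> * v \<le> max (l * v) (r * v)}"
    then have *: "\<xi> * v \<le> max (l * v) (r * v)" for v by simp
    \<comment> \<open>The directions 1 and -1 already force the upper and the lower bound.\<close>
    show "\<xi> \<in> {l..r}" using *[of 1] *[of "-1"] \<open>l \<le> r\<close> by simp
  next
    fix \<xi> assume \<xi>: "\<xi> \<in> {l..r}"
    have "\<xi> * v \<le> max (l * v) (r * v)" for v
    proof (cases "0 \<le> v")
      case True then show ?thesis using \<xi> mult_right_mono[of \<xi> r v] by simp
    next
      case False then show ?thesis using \<xi> mult_right_mono_neg[of l \<xi> v] by simp
    qed
    then show "\<xi> \<in> {\<xi>. \<forall>v. \<xi> * v \<le> max (l * v) (r * v)}" by simp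
  qed
  finally show ?thesis .
qed

text \<open>Both components have the form \<open>phi x + c * x\<close>, so one computation with
  slope offset \<open>c\<close> serves for \<open>f1\<close> and \<open>f2\<close>. Away from the
  kinks, \<open>d\<close> is the distance to the nearest one.\<close>

lemma D_comp_kink:
  assumes "i = 1 \<and> c = 1 \<or> i = 2 \<and> c = -1"
  shows "\<bar>x\<bar> < 1 \<Longrightarrow> D_comp i x = {c}"
    and "x = 1 \<Longrightarrow> D_comp i x = {c..c + 1}"
    and "x = -1 \<Longrightarrow> D_comp i x = {c - 1..c}"
    and "1 < x \<Longrightarrow> D_comp i x = {c + 1}"
    and "x < -1 \<Longrightarrow> D_comp i x = {c - 1}"
proof -
  have D: "D_comp i x = clarke_subdifferential (\<lambda>x. phi x + c * x) x"
    using assms by (auto simp: D_comp_def f1_def f2_def fun_eq_iff intro!: arg_cong2[where f=clarke_subdifferential])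
  show "D_comp i x = {c}" if "\<bar>x\<bar> < 1"
    unfolding D by (subst clarke_subdifferential_kink[where d="1 - \<bar>x\<bar>" and l=c and r=c])
      (use that in \<open>auto simp: phi_def max_def algebra_simps\<close>)
  show "D_comp i x = {c..c + 1}" if "x = 1"
    unfolding D by (rule clarke_subdifferential_kink[where d=1])
      (use that in \<open>auto simp: phi_def max_def algebra_simps\<close>)
  show "D_comp i x = {c - 1..c}" if "x = -1"
    unfolding D by (rule clarke_subdifferential_kink[where d=1])
      (use that in \<open>auto simp: phi_def max_def algebra_simps\<close>)
  show "D_comp i x = {c + 1}" if "1 < x"
    unfolding D by (subst clarke_subdifferential_kink[where d="\<bar>x\<bar> - 1" and l="c + 1" and r="c + 1"])
      (use that in \<open>auto simp: phi_def max_def algebra_simps\<close>)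
  show "D_comp i x = {c - 1}" if "x < -1"
    unfolding D by (subst clarke_subdifferential_kink[where d="\<bar>x\<bar> - 1" and l="c - 1" and r="c - 1"])
      (use that in \<open>auto simp: phi_def max_def algebra_simps\<close>)
qed

lemma atLeastAtMost_set_plus:
  fixes a b c d :: real
  assumes "a \<le> b" "c \<le> d"
  shows "{a..b} + {c..d} = {a + c..b + d}"
proof (intro set_eqI iffI)
  fix x assume x: "x \<in> {a + c..b + d}"
  \<comment> \<open>\<open>max a (x - d)\<close> is the least point at or above \<open>a\<close>
    that leaves a remainder of at most \<open>d\<close>.\<close>
  have "x = max a (x - d) + (x - max a (x - d))" by simp
  then show "x \<in> {a..b} + {c..d}"
    by (rule ssubst, intro set_plus_intro) (use x assms in auto)
qed (auto elim!: set_plus_elim)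

text \<open>The simplifier turns the index 1 into \<open>Suc 0\<close>, so the rules must be
  available in that form.\<close>

lemmas D_comp_simps = D_comp_kink[of 1 1, unfolded One_nat_def] D_comp_kink[of 2 "-1"]

lemma D_J_eq:
  shows "\<bar>x\<bar> < 1 \<Longrightarrow> D_J x = {0}"
    and "x = 1 \<Longrightarrow> D_J x = {0..1}"
    and "x = -1 \<Longrightarrow> D_J x = {-1..0}"
    and "1 < x \<Longrightarrow> D_J x = {1}"
    and "x < -1 \<Longrightarrow> D_J x = {-1}"
proof -
  have pt: "{a} + {b} = {a + b}" for a b :: real
    by (auto simp: set_plus_def)
  show "\<bar>x\<bar> < 1 \<Longrightarrow> D_J x = {0}" "1 < x \<Longrightarrow> D_J x = {1}" "x < -1 \<Longrightarrow> D_J x = {-1}"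
    by (simp_all add: D_J_def D_comp_simps pt)
  have im: "(\<lambda>d. 1 / 2 * d) ` {a..b} = {a / 2..b / 2}" for a b :: real
    using image_mult_atLeastAtMost[of "1/2" a b] by simp
  show "x = 1 \<Longrightarrow> D_J x = {0..1}" "x = -1 \<Longrightarrow> D_J x = {-1..0}"
    by (simp_all add: D_J_def D_comp_simps atLeastAtMost_set_plus im)
qed

lemma crit_J_eq: "crit_J = {-1..1}"
proof (intro set_eqI iffI)
  fix x assume "x \<in> crit_J"
  then show "x \<in> {-1..1}"
    using D_J_eq(4,5)[of x] by (force simp: crit_J_def)
next
  fix x :: real assume "x \<in> {-1..1}"
  then consider "\<bar>x\<bar> < 1" | "x = 1" | "x = -1" by fastforce
  then show "x \<in> crit_J"
    by cases (simp_all add: crit_J_def D_J_eq)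
qed

lemma g_batch_interval:
  assumes "G_batch B x = {a..b}" "a \<le> b"
  shows "g_batch B x = max a (min b 0)"
  unfolding g_batch_def assms(1)
  by (rule closest_point_unique[symmetric]) (use assms(2) in \<open>auto simp: dist_real_def\<close>)

lemma g_batch_singleton:
  assumes "G_batch B x = {c}"
  shows "g_batch B x = c"
  using g_batch_interval[of B x c c] assms by simp

lemma G_batch_eq:
  "G_batch {1} x = D_comp 1 x" "G_batch {2} x = D_comp 2 x" "G_batch {1, 2} x = D_J x"
  by (simp_all add: G_batch_def D_J_def)

lemmas g_batch_simps = g_batch_singleton g_batch_interval G_batch_eq[unfolded One_nat_def]
  D_comp_simps D_J_eq

section \<open>The iteration as a clipped lazy walk\<close>

text \<open>For the three batches this is minus the slope of the averaged function on the open
  interval between -1 and 1.\<close>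

definition batch_shift :: "nat set \<Rightarrow> real" where
  "batch_shift b = (if b = {1} then -1 else if b = {2} then 1 else 0)"

definition clip_step :: "real \<Rightarrow> real \<Rightarrow> nat set \<Rightarrow> real" where
  "clip_step a x b = max (-1) (min 1 (x + a * batch_shift b))"

lemma batch_shift_simps [simp]: "batch_shift {Suc 0} = -1" "batch_shift {2} = 1" "batch_shift {Suc 0, 2} = 0"
  by (auto simp: batch_shift_def)

text \<open>At an end point, every batch that would push outwards has 0 in its subdifferential, so
  the selector vanishes, which is what clipping does; inward moves have full length
  \<open>a\<close>. In the remaining case the distance to the ends is at least \<open>a\<close>, and
  nothing is clipped.\<close>

lemma g_batch_step:
  assumes "b \<in> batches" "0 < a" "a \<le> 1" "x = 1 \<or> x = -1 \<or> \<bar>x\<bar> \<le> 1 - a"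
  shows "x - a * g_batch b x = clip_step a x b"
proof -
  have b: "b = {1} \<or> b = {2} \<or> b = {1, 2}" using assms(1) by (auto simp: batches_def)
  consider "x = 1" | "x = -1" | "\<bar>x\<bar> \<le> 1 - a" using assms(4) by blast
  then show ?thesis
  proof cases
    case 1
    have "g_batch {1} x = 1" "g_batch {2} x = 0" "g_batch {1, 2} x = 0"
      using 1 by (simp_all add: g_batch_simps)
    then show ?thesis using b assms 1 by (auto simp: clip_step_def)
  next
    case 2
    have "g_batch {1} x = 0" "g_batch {2} x = -1" "g_batch {1, 2} x = 0"
      using 2 by (simp_all add: g_batch_simps)
    then show ?thesis using b assms 2 by (auto simp: clip_step_def)
  next
    case 3
    then have x: "\<bar>x\<bar> < 1" using assms(2) by simp
    have "g_batch {1} x = 1" "g_batch {2} x = -1" "g_batch {1, 2} x = 0"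
      using x by (simp_all add: g_batch_simps)
    then show ?thesis using b assms 3 by (auto simp: clip_step_def)
  qed
qed

lemma clip_step_abs_le: "\<bar>clip_step a x b\<bar> \<le> 1"
  by (simp add: clip_step_def abs_le_iff)

text \<open>Clipping to an interval is nonexpansive and fixes \<open>x\<close>.\<close>

lemma clip_step_diff_le:
  assumes "\<bar>x\<bar> \<le> 1" "0 < a"
  shows "\<bar>clip_step a x b - x\<bar> \<le> a"
proof -
  have "\<bar>max (-1) (min 1 (x + h)) - x\<bar> \<le> \<bar>h\<bar>" for h
    using assms(1) by (auto simp: max_def min_def)
  moreover have "\<bar>a * batch_shift b\<bar> \<le> a" using assms(2) by (auto simp: batch_shift_def)
  ultimately show ?thesis unfolding clip_step_def by (rule order_trans)
qed

lemma sum_batches: "(\<Sum>b\<in>batches. f b) = f {1} + f {2} + f {1, 2}"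
  by (auto simp: batches_def sum.insert_if add.assoc)

lemma finite_batches [simp]: "finite batches"
  and card_batches: "card batches = 3"
  by (auto simp: batches_def card_insert_if)

text \<open>The sign \<open>s\<close> selects the target end point, and \<open>s * x + 1\<close> is
  the distance from the opposite one. Subtracting 4 makes the potential vanish at the target.
  Without reflection the mean gain is \<open>2 * a\<^sup>2 / 3\<close>; half of it survives
  reflection.\<close>

lemma clip_step_drift:
  fixes s :: real
  assumes "s = 1 \<or> s = -1" "0 < a" "-1 \<le> s * x" "s * x + a \<le> 1"
  shows "(s * x + 1)\<^sup>2 - 4 + a\<^sup>2 / 3 \<le> (\<Sum>b\<in>batches. (s * clip_step a x b + 1)\<^sup>2 - 4) / 3"
proof -
  define y where "y = s * x + 1"
  have y: "0 \<le> y" "y + a \<le> 2" using assms by (auto simp: y_def)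
  have "(\<Sum>b\<in>batches. (s * clip_step a x b + 1)\<^sup>2 - 4) = (max 0 (y - a))\<^sup>2 + y\<^sup>2 + (y + a)\<^sup>2 - 12"
  proof -
    \<comment> \<open>Which of the batches \<open>{1}\<close> and \<open>{2}\<close> moves towards
      the target depends on \<open>s\<close>, but the sum does not see the order.\<close>
    have "(s * clip_step a x {1} + 1, s * clip_step a x {2} + 1) \<in> {(max 0 (y - a), y + a), (y + a, max 0 (y - a))}"
      using assms y by (auto simp: y_def clip_step_def)
    moreover have "s * clip_step a x {1, 2} + 1 = y"
      using assms y by (auto simp: y_def clip_step_def)
    ultimately show ?thesis by (auto simp: sum_batches add_ac)
  qed
  moreover have "(max 0 (y - a))\<^sup>2 + y\<^sup>2 + (y + a)\<^sup>2 \<ge> 3 * y\<^sup>2 + a\<^sup>2"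
  proof (cases "y \<le> a")
    case True
    then have "y * y \<le> a * y" using y by (intro mult_right_mono)
    moreover have "0 \<le> a * y" using y assms by simp
    ultimately show ?thesis using True by (simp add: power2_eq_square algebra_simps)
  next
    case False
    then show ?thesis by (simp add: power2_eq_square algebra_simps)
  qed
  ultimately show ?thesis by (simp add: y_def)
qed

section \<open>Walks on dyadic grids\<close>

lemma iterates_cong:
  "(\<And>i. i < k \<Longrightarrow> b i = b' i) \<Longrightarrow> iterates \<alpha> b k = iterates \<alpha> b' k"
  by (induction k) auto

text \<open>Monotone exponents make the grids nested, so a point of the current grid stays on all
  later ones.\<close>

locale dyadic_steps =
  fixes m :: "nat \<Rightarrow> nat" and \<alpha> :: "nat \<Rightarrow> real"
  assumes mono_m: "mono m" and \<alpha>_eq: "\<alpha> k = 1 / 2 ^ m k"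
begin

lemma \<alpha>_pos: "0 < \<alpha> k" and \<alpha>_le_1: "\<alpha> k \<le> 1"
  by (simp_all add: \<alpha>_eq)

text \<open>As \<open>1\<close> lies on every dyadic grid, a walk on the grid meets \<open>\<plusminus>1\<close> exactly instead of
  jumping over them.\<close>

lemma grid_gap:
  assumes "x * 2 ^ m k \<in> \<int>" "x < 1"
  shows "x + \<alpha> k \<le> 1"
proof -
  obtain z where z: "x * 2 ^ m k = of_int z" using assms(1) by (elim Ints_cases)
  have "x * 2 ^ m k < 2 ^ m k" using assms(2) by simp
  then have "of_int z < (of_int (2 ^ m k) :: real)" by (simp add: z)
  then have "of_int (z + 1) \<le> (of_int (2 ^ m k) :: real)" unfolding of_int_less_iff of_int_le_iff by simp
  then have "x * 2 ^ m k + 1 \<le> 2 ^ m k" by (simp add: z)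
  then show ?thesis by (simp add: \<alpha>_eq field_simps)
qed

text \<open>The two claims support each other: being on the grid turns the iteration into a clipped
  step, and a clipped step stays on the grid.\<close>

lemma iterates_grid:
  assumes "\<And>i. i < k \<Longrightarrow> b i \<in> batches"
  shows "iterates \<alpha> b k * 2 ^ m k \<in> \<int> \<and> \<bar>iterates \<alpha> b k\<bar> \<le> 1"
    and "c \<in> batches \<Longrightarrow>
      iterates \<alpha> b k - \<alpha> k * g_batch c (iterates \<alpha> b k) = clip_step (\<alpha> k) (iterates \<alpha> b k) c"
proof -
  have step: "x - \<alpha> k * g_batch c x = clip_step (\<alpha> k) x c"
    if "x * 2 ^ m k \<in> \<int>" "\<bar>x\<bar> \<le> 1" "c \<in> batches" for x k c
  proof (rule g_batch_step[OF that(3) \<alpha>_pos \<alpha>_le_1])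
    \<comment> \<open>The mirror image lies on the grid too, so \<open>grid_gap\<close> also
      controls the distance to -1.\<close>
    have "-x * 2 ^ m k \<in> \<int>" using Ints_minus[OF that(1)] by simp
    from grid_gap[OF this] grid_gap[OF that(1)] that(2)
    show "x = 1 \<or> x = -1 \<or> \<bar>x\<bar> \<le> 1 - \<alpha> k" by linarith
  qed
  show inv: "iterates \<alpha> b k * 2 ^ m k \<in> \<int> \<and> \<bar>iterates \<alpha> b k\<bar> \<le> 1"
    using assms
  proof (induction k)
    case 0 show ?case by simp
  next
    case (Suc k)
    let ?w = "iterates \<alpha> b k"
    have IH: "?w * 2 ^ m k \<in> \<int>" "\<bar>?w\<bar> \<le> 1" and bk: "b k \<in> batches"
      using Suc by auto
    have eq: "iterates \<alpha> b (Suc k) = clip_step (\<alpha> k) ?w (b k)"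
      using step[OF IH bk] by simp
    \<comment> \<open>Scaled by \<open>2 ^ m k\<close>, the step adds an integer and clips at
      integers.\<close>
    have "clip_step (\<alpha> k) ?w (b k) * 2 ^ m k
      = max (- (2 ^ m k)) (min (2 ^ m k) (?w * 2 ^ m k + batch_shift (b k)))"
    proof -
      have "max (-1) (min 1 (x + h / P)) * P = max (- P) (min P (x * P + h))" if "0 < P" for x h P :: real
        using that by (auto simp: max_def min_def field_simps)
      then show ?thesis by (simp add: clip_step_def \<alpha>_eq)
    qed
    also have "\<dots> \<in> \<int>"
      using IH by (auto simp: max_def min_def batch_shift_def)
    finally have "clip_step (\<alpha> k) ?w (b k) * 2 ^ m k * 2 ^ (m (Suc k) - m k) \<in> \<int>"
      by (rule Ints_mult) auto
    moreover have "(2::real) ^ m k * 2 ^ (m (Suc k) - m k) = 2 ^ m (Suc k)"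
      using monoD[OF mono_m, of k "Suc k"] by (simp flip: power_add)
    ultimately have "clip_step (\<alpha> k) ?w (b k) * 2 ^ m (Suc k) \<in> \<int>"
      by (simp add: mult.assoc)
    then show ?case unfolding eq by (simp add: clip_step_abs_le)
  qed
  then show "c \<in> batches \<Longrightarrow>
      iterates \<alpha> b k - \<alpha> k * g_batch c (iterates \<alpha> b k) = clip_step (\<alpha> k) (iterates \<alpha> b k) c"
    by (intro step) auto
qed

end

section \<open>Independent batches and averaging over the next batch\<close>

locale iid_batches = prob_space M for M :: "'w measure" +
  fixes B :: "nat \<Rightarrow> 'w \<Rightarrow> nat set"
  assumes indep_B: "indep_vars (\<lambda>_. count_space batches) B UNIV"
    and distr_B: "distr M (count_space batches) (B k) = uniform_count_measure batches"
begin

lemma B_measurable [measurable]: "B k \<in> M \<rightarrow>\<^sub>M count_space batches"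
  using indep_B by (simp add: indep_vars_def)

lemma B_in_batches: "\<omega> \<in> space M \<Longrightarrow> B k \<omega> \<in> batches"
  using measurable_space[OF B_measurable] by simp

lemma prob_B_eq:
  assumes "c \<in> batches"
  shows "prob {\<omega> \<in> space M. B k \<omega> = c} = 1 / 3"
proof -
  have "prob {\<omega> \<in> space M. B k \<omega> = c} = measure (distr M (count_space batches) (B k)) {c}"
    using assms by (subst measure_distr) (auto intro!: arg_cong[where f=prob])
  also have "\<dots> = 1 / 3"
    using assms by (simp add: distr_B measure_uniform_count_measure card_batches)
  finally show ?thesis .
qed

text \<open>This is an elementary form of adaptedness: such a quantity is a function on the finite
  set of prefixes of length \<open>k\<close>, and no filtration or conditional expectation has to be
  set up.\<close>

definition past_dependent :: "nat \<Rightarrow> ((nat \<Rightarrow> nat set) \<Rightarrow> real) \<Rightarrow> bool" where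
  "past_dependent k F \<longleftrightarrow> (\<forall>b b'. (\<forall>i<k. b i = b' i) \<longrightarrow> F b = F b')"

lemma past_dependentI:
  "(\<And>b b'. (\<And>i. i < k \<Longrightarrow> b i = b' i) \<Longrightarrow> F b = F b') \<Longrightarrow> past_dependent k F"
  unfolding past_dependent_def by blast

lemma past_dependentD:
  "past_dependent k F \<Longrightarrow> (\<And>i. i < k \<Longrightarrow> b i = b' i) \<Longrightarrow> F b = F b'"
  unfolding past_dependent_def by blast

text \<open>The prefix space is discrete, hence every function on it is measurable.\<close>

lemma PiM_batches: "PiM {..<k} (\<lambda>_. count_space batches) = count_space (PiE {..<k} (\<lambda>_. batches))"
  for k :: nat
  by (rule count_space_PiM_finite) (auto intro: countable_finite)

lemma past_dependent_eq:
  assumes "past_dependent k F"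
  shows "F (\<lambda>i. B i \<omega>) = F (\<lambda>i\<in>{..<k}. B i \<omega>)"
  by (rule past_dependentD[OF assms]) simp

lemma past_dependent_measurable:
  assumes "past_dependent k F"
  shows "(\<lambda>\<omega>. F (\<lambda>i. B i \<omega>)) \<in> borel_measurable M"
proof -
  have "(\<lambda>\<omega>. \<lambda>i\<in>{..<k}. B i \<omega>) \<in> M \<rightarrow>\<^sub>M PiM {..<k} (\<lambda>_. count_space batches)"
    by measurable
  then have "(\<lambda>\<omega>. F (\<lambda>i\<in>{..<k}. B i \<omega>)) \<in> borel_measurable M"
    unfolding PiM_batches by (rule measurable_compose) simp
  then show ?thesis by (simp add: past_dependent_eq[OF assms])
qed

lemma past_dependent_integrable:
  assumes "past_dependent k F"
  shows "integrable M (\<lambda>\<omega>. F (\<lambda>i. B i \<omega>))"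
proof (rule integrable_const_bound[OF _ past_dependent_measurable[OF assms]], rule AE_I2)
  fix \<omega> assume "\<omega> \<in> space M"
  then have "(\<lambda>i\<in>{..<k}. B i \<omega>) \<in> PiE {..<k} (\<lambda>_. batches)"
    by (auto intro: B_in_batches)
  \<comment> \<open>There are finitely many prefixes, so summing over all of them gives a crude
    uniform bound.\<close>
  then show "norm (F (\<lambda>i. B i \<omega>)) \<le> (\<Sum>p\<in>PiE {..<k} (\<lambda>_. batches). \<bar>F p\<bar>)"
    unfolding past_dependent_eq[OF assms]
    by (auto intro!: member_le_sum[where f="\<lambda>p. \<bar>F p\<bar>"] finite_PiE)
qed

text \<open>The prefix before \<open>k\<close> and the batch at time \<open>k\<close> are
  independent, and each batch has probability 1/3.\<close>

lemma expectation_past_indicator: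
  assumes F: "past_dependent k F" and c: "c \<in> batches"
  shows "integrable M (\<lambda>\<omega>. F (\<lambda>i. B i \<omega>) * of_bool (B k \<omega> = c))"
    and "expectation (\<lambda>\<omega>. F (\<lambda>i. B i \<omega>) * of_bool (B k \<omega> = c))
      = expectation (\<lambda>\<omega>. F (\<lambda>i. B i \<omega>)) / 3"
proof -
  have "indep_var (PiM {..<k} (\<lambda>_. count_space batches)) (\<lambda>\<omega>. \<lambda>i\<in>{..<k}. B i \<omega>)
      (PiM {k} (\<lambda>_. count_space batches)) (\<lambda>\<omega>. \<lambda>i\<in>{k}. B i \<omega>)"
    by (rule indep_var_restrict[OF indep_B]) auto
  then have "indep_var borel (F \<circ> (\<lambda>\<omega>. \<lambda>i\<in>{..<k}. B i \<omega>))
      borel ((\<lambda>p. of_bool (p k = c)) \<circ> (\<lambda>\<omega>. \<lambda>i\<in>{k}. B i \<omega>))"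
  proof (rule indep_var_compose)
    show "F \<in> borel_measurable (PiM {..<k} (\<lambda>_. count_space batches))"
      by (simp add: PiM_batches)
    have "(\<lambda>p. p k) \<in> PiM {k} (\<lambda>_. count_space batches) \<rightarrow>\<^sub>M count_space batches"
      by measurable
    then show "(\<lambda>p. of_bool (p k = c) :: real) \<in> borel_measurable (PiM {k} (\<lambda>_. count_space batches))"
      by (rule measurable_compose) simp
  qed
  then have ind: "indep_var borel (\<lambda>\<omega>. F (\<lambda>i. B i \<omega>)) borel (\<lambda>\<omega>. of_bool (B k \<omega> = c) :: real)"
    by (simp add: comp_def past_dependent_eq[OF F])
  have iF: "integrable M (\<lambda>\<omega>. F (\<lambda>i. B i \<omega>))"
    by (rule past_dependent_integrable[OF F])
  have eq: "of_bool (B k \<omega> = c) = indicat_real {\<omega> \<in> space M. B k \<omega> = c} \<omega>" if "\<omega> \<in> space M" for \<omega>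
    using that by (simp add: indicator_def)
  have sets: "{\<omega> \<in> space M. B k \<omega> = c} \<in> events"
    using measurable_sets[OF B_measurable[of k], of "{c}"] c by (simp add: vimage_def Int_def conj_commute)
  have iI: "integrable M (\<lambda>\<omega>. of_bool (B k \<omega> = c) :: real)"
    by (subst Bochner_Integration.integrable_cong[OF refl eq]) (use sets in \<open>auto simp: emeasure_eq_measure\<close>)
  have "expectation (\<lambda>\<omega>. of_bool (B k \<omega> = c)) = prob {\<omega> \<in> space M. B k \<omega> = c}"
    by (subst Bochner_Integration.integral_cong[OF refl eq]) (use sets in auto)
  then show "expectation (\<lambda>\<omega>. F (\<lambda>i. B i \<omega>) * of_bool (B k \<omega> = c))
      = expectation (\<lambda>\<omega>. F (\<lambda>i. B i \<omega>)) / 3"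
    using indep_var_lebesgue_integral[OF ind iF iI] prob_B_eq[OF c] by simp
  show "integrable M (\<lambda>\<omega>. F (\<lambda>i. B i \<omega>) * of_bool (B k \<omega> = c))"
    by (rule indep_var_integrable[OF ind iF iI])
qed

text \<open>Splitting by the three values of \<open>B k\<close> replaces conditioning on the
  past.\<close>

lemma expectation_past_step:
  assumes "\<And>c. past_dependent k (\<lambda>b. H b c)"
  shows "expectation (\<lambda>\<omega>. H (\<lambda>i. B i \<omega>) (B k \<omega>))
    = expectation (\<lambda>\<omega>. (\<Sum>c\<in>batches. H (\<lambda>i. B i \<omega>) c) / 3)"
proof -
  have "expectation (\<lambda>\<omega>. H (\<lambda>i. B i \<omega>) (B k \<omega>))
    = expectation (\<lambda>\<omega>. \<Sum>c\<in>batches. H (\<lambda>i. B i \<omega>) c * of_bool (B k \<omega> = c))"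
  proof (rule Bochner_Integration.integral_cong[OF refl])
    fix \<omega> assume "\<omega> \<in> space M"
    then have "B k \<omega> \<in> batches" by (rule B_in_batches)
    then show "H (\<lambda>i. B i \<omega>) (B k \<omega>) = (\<Sum>c\<in>batches. H (\<lambda>i. B i \<omega>) c * of_bool (B k \<omega> = c))"
      by (simp add: of_bool_def if_distrib cong: if_cong)
  qed
  also have "\<dots> = (\<Sum>c\<in>batches. expectation (\<lambda>\<omega>. H (\<lambda>i. B i \<omega>) c * of_bool (B k \<omega> = c)))"
    by (rule Bochner_Integration.integral_sum) (rule expectation_past_indicator(1)[OF assms])
  also have "\<dots> = (\<Sum>c\<in>batches. expectation (\<lambda>\<omega>. H (\<lambda>i. B i \<omega>) c) / 3)"
    by (rule sum.cong[OF refl]) (rule expectation_past_indicator(2)[OF assms])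
  also have "\<dots> = (\<Sum>c\<in>batches. expectation (\<lambda>\<omega>. H (\<lambda>i. B i \<omega>) c)) / 3"
    by (rule sum_divide_distrib[symmetric])
  also have "(\<Sum>c\<in>batches. expectation (\<lambda>\<omega>. H (\<lambda>i. B i \<omega>) c))
    = expectation (\<lambda>\<omega>. \<Sum>c\<in>batches. H (\<lambda>i. B i \<omega>) c)"
    by (rule Bochner_Integration.integral_sum[symmetric]) (rule past_dependent_integrable[OF assms])
  also have "\<dots> / 3 = expectation (\<lambda>\<omega>. (\<Sum>c\<in>batches. H (\<lambda>i. B i \<omega>) c) / 3)"
    by simp
  finally show ?thesis .
qed

end

section \<open>The walk almost surely returns to both end points\<close>

locale dyadic_walk = dyadic_steps m \<alpha> + iid_batches M B
  for m \<alpha> and M :: "'w measure" and B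
begin

abbreviation w :: "'w \<Rightarrow> nat \<Rightarrow> real" where
  "w \<omega> \<equiv> iterates \<alpha> (\<lambda>k. B k \<omega>)"

lemma w_grid:
  assumes "\<omega> \<in> space M"
  shows "w \<omega> k * 2 ^ m k \<in> \<int>" "\<bar>w \<omega> k\<bar> \<le> 1"
    "c \<in> batches \<Longrightarrow> w \<omega> k - \<alpha> k * g_batch c (w \<omega> k) = clip_step (\<alpha> k) (w \<omega> k) c"
  using iterates_grid[of k "\<lambda>k. B k \<omega>"] B_in_batches[OF assms] by auto

text \<open>As long as \<open>s w\<close> has not reached \<open>1\<close>, the square of \<open>s w\<^sub>k + 1\<close> has drift at least
  \<open>\<alpha>\<^sub>k\<^sup>2 / 3\<close> (reflection at \<open>-1\<close> costs half of the variance \<open>2 \<alpha>\<^sub>k\<^sup>2 / 3\<close>). Since it is bounded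
  by \<open>4\<close> and \<open>\<Sum>\<alpha>\<^sub>k\<^sup>2\<close> diverges, \<open>s w\<close> reaches \<open>1\<close> after any time \<open>j\<close>.\<close>

lemma AE_hits:
  fixes s :: real
  assumes s: "s = 1 \<or> s = -1" and div: "\<not> summable (\<lambda>k. (\<alpha> k)\<^sup>2)"
  shows "AE \<omega> in M. \<exists>k\<ge>j. s * w \<omega> k = 1"
proof -
  \<comment> \<open>\<open>q\<close> indicates that the target has not been met from time
    \<open>j\<close> through \<open>k\<close>. \<open>Z\<close> is the potential stopped at the
    first such meeting: it is 0 from then on, which is also the value of the potential at the
    target.\<close>
  define q where "q b k = (of_bool (\<forall>i\<in>{j..k}. s * iterates \<alpha> b i < 1) :: real)" for b k
  define Z where "Z b k = q b k * ((s * iterates \<alpha> b k + 1)\<^sup>2 - 4)" for b k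
  have q01: "0 \<le> q b k" "q b k \<le> 1" for b k by (auto simp: q_def)
  have it: "iterates \<alpha> b i = iterates \<alpha> b' i" if "\<And>i. i < k \<Longrightarrow> b i = b' i" "i \<le> k" for b b' i k
    by (rule iterates_cong) (use that in auto)
  have past_q: "past_dependent k (\<lambda>b. q b k)" for k
  proof (rule past_dependentI)
    fix b b' :: "nat \<Rightarrow> nat set" assume eq: "\<And>i. i < k \<Longrightarrow> b i = b' i"
    have "\<forall>i\<in>{j..k}. iterates \<alpha> b i = iterates \<alpha> b' i"
      using it[OF eq] by simp
    then show "q b k = q b' k" by (simp add: q_def)
  qed
  have past_Z: "past_dependent k (\<lambda>b. Z b k)" for k
  proof (rule past_dependentI)
    fix b b' :: "nat \<Rightarrow> nat set" assume eq: "\<And>i. i < k \<Longrightarrow> b i = b' i"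
    show "Z b k = Z b' k"
      unfolding Z_def using past_dependentD[OF past_q eq] it[OF eq order_refl] by simp
  qed
  let ?E = "\<lambda>F. expectation (\<lambda>\<omega>. F (\<lambda>i. B i \<omega>))"
  have sw: "-1 \<le> s * w \<omega> k" "s * w \<omega> k \<le> 1" if "\<omega> \<in> space M" for \<omega> k
    using w_grid(2)[OF that, of k] s by auto
  have gap: "s * w \<omega> k + \<alpha> k \<le> 1" if "\<omega> \<in> space M" "s * w \<omega> k < 1" for \<omega> k
  proof (rule grid_gap[OF _ that(2)])
    show "s * w \<omega> k * 2 ^ m k \<in> \<int>"
      using s w_grid(1)[OF that(1), of k] Ints_minus[OF w_grid(1)[OF that(1), of k]] by auto
  qed
  have Z_bounds: "-4 \<le> Z (\<lambda>i. B i \<omega>) k" "Z (\<lambda>i. B i \<omega>) k \<le> 0" if "\<omega> \<in> space M" for \<omega> k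
  proof -
    have "(s * w \<omega> k + 1)\<^sup>2 \<le> 2\<^sup>2"
      using sw[OF that, of k] by (intro power_mono) auto
    then show "-4 \<le> Z (\<lambda>i. B i \<omega>) k" "Z (\<lambda>i. B i \<omega>) k \<le> 0"
      by (auto simp: Z_def q_def)
  qed
  have drift: "?E (\<lambda>b. Z b k) + (\<alpha> k)\<^sup>2 / 3 * ?E (\<lambda>b. q b k) \<le> ?E (\<lambda>b. Z b (Suc k))" if "j \<le> k" for k
  proof -
    \<comment> \<open>The indicator is kept at time \<open>k\<close>, so that for a fixed batch
      \<open>c\<close> only the past enters.\<close>
    let ?H = "\<lambda>b c. q b k * ((s * clip_step (\<alpha> k) (iterates \<alpha> b k) c + 1)\<^sup>2 - 4)"
    have past_H: "past_dependent k (\<lambda>b. ?H b c)" for c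
    proof (rule past_dependentI)
      fix b b' :: "nat \<Rightarrow> nat set" assume eq: "\<And>i. i < k \<Longrightarrow> b i = b' i"
      show "?H b c = ?H b' c"
        using past_dependentD[OF past_q eq] it[OF eq order_refl] by simp
    qed
    have "?E (\<lambda>b. Z b (Suc k)) = expectation (\<lambda>\<omega>. ?H (\<lambda>i. B i \<omega>) (B k \<omega>))"
    proof (rule Bochner_Integration.integral_cong[OF refl])
      fix \<omega> assume \<omega>: "\<omega> \<in> space M"
      have "w \<omega> (Suc k) = clip_step (\<alpha> k) (w \<omega> k) (B k \<omega>)"
        using w_grid(3)[OF \<omega>] B_in_batches[OF \<omega>] by simp
      moreover have "q (\<lambda>i. B i \<omega>) (Suc k) = q (\<lambda>i. B i \<omega>) k * of_bool (s * w \<omega> (Suc k) < 1)"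
        using that by (auto simp: q_def atLeastAtMostSuc_conv simp del: iterates.simps)
      \<comment> \<open>If the target is met at this very step, \<open>q\<close> drops to 0, but the
        potential is 0 there anyway, so \<open>q\<close> at time \<open>k\<close> may be used
        instead.\<close>
      moreover have "(s * w \<omega> (Suc k) + 1)\<^sup>2 - 4 = 0" if "\<not> s * w \<omega> (Suc k) < 1"
      proof -
        have "s * w \<omega> (Suc k) = 1" using that sw(2)[OF \<omega>, of "Suc k"] by linarith
        then show ?thesis by simp
      qed
      ultimately show "Z (\<lambda>i. B i \<omega>) (Suc k) = ?H (\<lambda>i. B i \<omega>) (B k \<omega>)"
        by (auto simp: Z_def of_bool_def simp del: iterates.simps)
    qed
    also have "\<dots> = expectation (\<lambda>\<omega>. (\<Sum>c\<in>batches. ?H (\<lambda>i. B i \<omega>) c) / 3)"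
      by (rule expectation_past_step[OF past_H])
    also have "\<dots> \<ge> expectation (\<lambda>\<omega>. Z (\<lambda>i. B i \<omega>) k + (\<alpha> k)\<^sup>2 / 3 * q (\<lambda>i. B i \<omega>) k)"
    proof (rule integral_mono)
      fix \<omega> assume \<omega>: "\<omega> \<in> space M"
      show "Z (\<lambda>i. B i \<omega>) k + (\<alpha> k)\<^sup>2 / 3 * q (\<lambda>i. B i \<omega>) k
        \<le> (\<Sum>c\<in>batches. ?H (\<lambda>i. B i \<omega>) c) / 3"
      proof (cases "q (\<lambda>i. B i \<omega>) k = 0")
        case True then show ?thesis by (simp add: Z_def)
      next
        case False
        then have "\<forall>i\<in>{j..k}. s * w \<omega> i < 1" and q1: "q (\<lambda>i. B i \<omega>) k = 1"
          by (auto simp: q_def)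
        then have "s * w \<omega> k < 1" using that by simp
        then show ?thesis
          using clip_step_drift[OF s \<alpha>_pos sw(1)[OF \<omega>] gap[OF \<omega>]] by (simp add: Z_def q1)
      qed
    qed (auto intro!: Bochner_Integration.integrable_add Bochner_Integration.integrable_sum
        integrable_divide integrable_mult_right past_dependent_integrable[OF past_H]
        past_dependent_integrable[OF past_Z] past_dependent_integrable[OF past_q])
    finally show ?thesis
      by (simp add: past_dependent_integrable[OF past_Z] past_dependent_integrable[OF past_q])
  qed
  define N where "N = {\<omega> \<in> space M. \<forall>k\<ge>j. s * w \<omega> k < 1}"
  have past_w: "past_dependent k (\<lambda>b. iterates \<alpha> b k)" for k
    by (rule past_dependentI) (rule iterates_cong)
  have [measurable]: "(\<lambda>\<omega>. w \<omega> k) \<in> borel_measurable M" for k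
    by (rule past_dependent_measurable[OF past_w])
  have N: "N \<in> events" unfolding N_def by measurable
  \<comment> \<open>On \<open>N\<close> the target is never met, so \<open>q\<close> equals 1 at all
    times.\<close>
  have prob_N: "prob N \<le> ?E (\<lambda>b. q b k)" for k
  proof -
    have "expectation (indicat_real N) \<le> ?E (\<lambda>b. q b k)"
      using N by (intro integral_mono past_dependent_integrable[OF past_q])
        (auto simp: indicator_def N_def q_def emeasure_eq_measure)
    then show ?thesis using N by simp
  qed
  have tele: "?E (\<lambda>b. Z b j) + prob N / 3 * (\<Sum>k<n. (\<alpha> (k + j))\<^sup>2) \<le> ?E (\<lambda>b. Z b (n + j))" for n
  proof (induction n)
    case 0 then show ?case by simp
  next
    case (Suc n)
    have "(\<alpha> (n + j))\<^sup>2 / 3 * prob N \<le> (\<alpha> (n + j))\<^sup>2 / 3 * ?E (\<lambda>b. q b (n + j))"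
      by (intro mult_left_mono prob_N) auto
    then show ?case using Suc drift[of "n + j"] by (simp add: algebra_simps)
  qed
  \<comment> \<open>The expectation of \<open>Z\<close> stays between -4 and 0, so it can rise by at
    most 4 in total.\<close>
  have bound: "prob N / 3 * (\<Sum>k<n. (\<alpha> (k + j))\<^sup>2) \<le> 4" for n
  proof -
    have "?E (\<lambda>b. Z b (n + j)) \<le> expectation (\<lambda>_. 0)"
      by (intro integral_mono past_dependent_integrable[OF past_Z]) (auto simp: Z_bounds)
    moreover have "expectation (\<lambda>_. -4) \<le> ?E (\<lambda>b. Z b j)"
      by (intro integral_mono past_dependent_integrable[OF past_Z]) (auto simp: Z_bounds)
    ultimately show ?thesis using tele[of n] by (simp add: prob_space)
  qed
  have "prob N = 0"
  proof (rule ccontr)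
    assume "prob N \<noteq> 0"
    then have pos: "prob N > 0" using measure_nonneg[of M N] by linarith
    have "summable (\<lambda>k. (\<alpha> (k + j))\<^sup>2)"
      by (rule summableI_nonneg_bounded[where x="12 / prob N"])
        (use bound pos in \<open>auto simp: field_simps\<close>)
    then show False using div summable_iff_shift[of "\<lambda>k. (\<alpha> k)\<^sup>2" j] by simp
  qed
  then have "AE \<omega> in M. \<omega> \<notin> N"
    using N by (simp add: prob_eq_0)
  then show ?thesis
  proof (rule AE_mp, intro AE_I2 impI)
    fix \<omega> assume \<omega>: "\<omega> \<in> space M" "\<omega> \<notin> N"
    then obtain k where "k \<ge> j" "\<not> s * w \<omega> k < 1" by (auto simp: N_def)
    then show "\<exists>k\<ge>j. s * w \<omega> k = 1"
      using sw(2)[OF \<omega>(1), of k] by (intro exI[of _ k]) auto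
  qed
qed

end

section \<open>Step sizes of order \<open>k\<^sup>-\<^sup>1\<^sup>/\<^sup>2\<close>\<close>

text \<open>The exponent \<open>\<lfloor>log\<^sub>4 (k + 1)\<rfloor>\<close> makes \<open>\<alpha>\<^sub>k\<close> a dyadic number of order \<open>1 / \<surd>k\<close>.\<close>

definition step_exponent :: "nat \<Rightarrow> nat" where
  "step_exponent k = nat \<lfloor>log 4 (real k + 1)\<rfloor>"

definition step_size :: "nat \<Rightarrow> real" where
  "step_size k = 1 / 2 ^ step_exponent k"

lemma mono_step_exponent: "mono step_exponent"
  unfolding step_exponent_def by (intro monoI nat_mono floor_mono) auto

text \<open>Base 4 in the exponent makes the square equal to \<open>1 / 4 ^ step_exponent k\<close>;
  rounding the logarithm down costs less than a factor 4.\<close>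

lemma step_size_square_bounds:
  "1 / (real k + 1) \<le> (step_size k)\<^sup>2" "(step_size k)\<^sup>2 \<le> 4 / (real k + 1)"
proof -
  let ?m = "step_exponent k"
  have "0 \<le> log 4 (real k + 1)" by simp
  then have m: "real ?m \<le> log 4 (real k + 1)" "log 4 (real k + 1) < real ?m + 1"
    unfolding step_exponent_def by linarith+
  have "4 powr real ?m \<le> real k + 1"
    using m(1) by (subst (asm) le_log_iff) auto
  then have lower: "4 ^ ?m \<le> real k + 1" by (simp add: powr_realpow)
  have "real k + 1 < 4 powr (real ?m + 1)"
    using m(2) by (subst (asm) log_less_iff) auto
  then have upper: "real k + 1 < 4 * 4 ^ ?m" by (simp add: powr_add powr_realpow)
  have "(2::real) ^ ?m * 2 ^ ?m = 4 ^ ?m" by (simp flip: power_mult_distrib)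
  then have square: "(step_size k)\<^sup>2 = 1 / 4 ^ ?m"
    by (simp add: step_size_def power2_eq_square)
  show "1 / (real k + 1) \<le> (step_size k)\<^sup>2" "(step_size k)\<^sup>2 \<le> 4 / (real k + 1)"
    unfolding square using lower upper by (simp_all add: field_simps)
qed

lemma step_size_pos: "0 < step_size k"
  by (simp add: step_size_def)

lemma step_size_le: "step_size k \<le> 2 / sqrt (real k + 1)"
  using real_le_rsqrt[OF step_size_square_bounds(2)[of k]] by (simp add: real_sqrt_divide)

lemma decseq_step_size: "decseq step_size"
  using monoD[OF mono_step_exponent]
  by (auto simp: decseq_def step_size_def intro!: divide_left_mono power_increasing)

lemma not_summable_step_size_square: "\<not> summable (\<lambda>k. (step_size k)\<^sup>2)"
proof
  assume "summable (\<lambda>k. (step_size k)\<^sup>2)"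
  then have "summable (\<lambda>k. 1 / (real k + 1))"
    by (rule summable_comparison_test') (use step_size_square_bounds in auto)
  then show False
    using not_summable_harmonic[where 'a=real] summable_iff_shift[of "\<lambda>k. 1 / real k" 1]
    by (simp add: inverse_eq_divide add.commute)
qed

lemma step_size_smallo: "step_size \<in> o(\<lambda>k. 1 / ln (real k))"
proof -
  have "step_size \<in> O(\<lambda>k. 2 / sqrt (real k + 1))"
    using step_size_le less_imp_le[OF step_size_pos] by (intro bigoI[where c=1]) auto
  also have "(\<lambda>k. 2 / sqrt (real k + 1)) \<in> o(\<lambda>k. 1 / ln (real k))"
    by real_asymp
  finally show ?thesis .
qed

lemma step_size_tendsto_0: "step_size \<longlonglongrightarrow> 0"
proof (rule tendsto_sandwich[OF _ _ tendsto_const])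
  show "(\<lambda>k. 2 / sqrt (real k + 1)) \<longlonglongrightarrow> 0" by real_asymp
qed (use step_size_le less_imp_le[OF step_size_pos] in auto)

section \<open>Accumulation points of real sequences\<close>

lemma Acc_closed_subset:
  assumes "closed S" "\<And>k. u k \<in> S"
  shows "Acc u \<subseteq> S"
proof
  fix x assume "x \<in> Acc u"
  then obtain r where "(\<lambda>j. u (r j)) \<longlonglongrightarrow> x" by (auto simp: Acc_def)
  then show "x \<in> S" by (rule closed_sequentially[OF assms(1), rotated]) (rule assms(2))
qed

lemma AccI:
  fixes u :: "nat \<Rightarrow> real"
  assumes "\<And>e j. e > 0 \<Longrightarrow> \<exists>k>j. \<bar>u k - x\<bar> < e"
  shows "x \<in> Acc u"
proof -
  have "\<exists>r. strict_mono r \<and> (\<forall>n. \<bar>u (r n) - x\<bar> < 1 / real (Suc n))"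
  proof -
    have "\<forall>n j. \<exists>k. j < k \<and> \<bar>u k - x\<bar> < 1 / real (Suc n)"
      using assms[of "1 / real (Suc _)"] by auto
    then obtain f where f: "\<And>n j. j < f n j \<and> \<bar>u (f n j) - x\<bar> < 1 / real (Suc n)"
      by metis
    \<comment> \<open>Each index is chosen beyond the previous one and with the next tolerance, so
      \<open>r\<close> increases strictly.\<close>
    define r where "r = rec_nat (f 0 0) (\<lambda>n. f (Suc n))"
    have "strict_mono r" by (simp add: strict_mono_Suc_iff r_def f)
    moreover have "\<bar>u (r n) - x\<bar> < 1 / real (Suc n)" for n
    proof (cases n)
      case 0
      then show ?thesis using f[of 0 0] by (simp add: r_def)
    next
      case (Suc i)
      then show ?thesis using f[of "r i" n] by (simp add: r_def)
    qed
    ultimately show ?thesis by blast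
  qed
  then obtain r where r: "strict_mono r" "\<And>n. \<bar>u (r n) - x\<bar> < 1 / real (Suc n)" by blast
  have "(\<lambda>n. u (r n) - x) \<longlonglongrightarrow> 0"
    by (rule Lim_null_comparison[OF _ LIMSEQ_Suc[OF lim_1_over_n]])
      (use r(2) in \<open>auto intro!: always_eventually less_imp_le\<close>)
  then show ?thesis using r(1) by (auto simp: Acc_def LIM_zero_iff)
qed

text \<open>Every subsequence of a convergent sequence has the same limit; two distinct accumulation
  points thus refute convergence.\<close>

lemma convergent_Acc_eq:
  assumes "convergent u" "x \<in> Acc u" "y \<in> Acc u"
  shows "x = y"
proof -
  obtain l where l: "u \<longlonglongrightarrow> l" using assms(1) by (auto simp: convergent_def)
  have eq: "z = l" if "z \<in> Acc u" for z
  proof -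
    obtain r where "strict_mono r" and r: "(\<lambda>j. u (r j)) \<longlonglongrightarrow> z"
      using \<open>z \<in> Acc u\<close> by (auto simp: Acc_def)
    then have "(\<lambda>j. u (r j)) \<longlonglongrightarrow> l"
      using LIMSEQ_subseq_LIMSEQ[OF l] by (simp add: comp_def)
    with r show ?thesis by (rule LIMSEQ_unique)
  qed
  show ?thesis using eq[OF assms(2)] eq[OF assms(3)] by simp
qed

text \<open>A discrete intermediate value argument: on its way from \<open>-1\<close> up to \<open>1\<close> the sequence cannot
  jump over an interval longer than its increments.\<close>

lemma Acc_oscillating:
  fixes u :: "nat \<Rightarrow> real"
  assumes incr: "(\<lambda>k. u (Suc k) - u k) \<longlonglongrightarrow> 0"
    and low: "\<And>j. \<exists>k\<ge>j. u k = a" and high: "\<And>j. \<exists>k\<ge>j. u k = b"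
    and x: "x \<in> {a..b}"
  shows "x \<in> Acc u"
proof (rule AccI)
  fix e :: real and j :: nat
  assume "e > 0"
  with incr have "eventually (\<lambda>k. \<bar>u (Suc k) - u k\<bar> < e) sequentially"
    by (auto dest!: tendstoD simp: dist_real_def)
  then obtain n where n: "\<And>k. k \<ge> n \<Longrightarrow> \<bar>u (Suc k) - u k\<bar> < e"
    by (auto simp: eventually_sequentially)
  \<comment> \<open>From \<open>p\<close> on, increments are below \<open>e\<close>;
    \<open>Suc j\<close> provides the strict inequality \<open>k > j\<close>.\<close>
  obtain p where p: "p \<ge> max n (Suc j)" "u p = a" using low by blast
  obtain q where q: "q \<ge> p" "u q = b" using high by blast
  \<comment> \<open>At the first time from \<open>p\<close> on at which the sequence reaches
    \<open>x\<close>, it overshoots by less than one increment. If that time is \<open>p\<close>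
    itself, then \<open>x = a\<close> and there is no predecessor to compare with.\<close>
  define k where "k = (LEAST k. k \<ge> p \<and> u k \<ge> x)"
  have k: "k \<ge> p" "u k \<ge> x"
    using LeastI[of "\<lambda>k. k \<ge> p \<and> u k \<ge> x" q] q x by (auto simp: k_def)
  show "\<exists>k>j. \<bar>u k - x\<bar> < e"
  proof (cases "k = p")
    case True
    then have "u p = x" using k p x by simp
    then show ?thesis using p \<open>e > 0\<close> by (intro exI[of _ p]) auto
  next
    case False
    then obtain i where i: "k = Suc i" "i \<ge> p" using k(1) by (cases k) auto
    have "u i < x"
      using not_less_Least[of i "\<lambda>k. k \<ge> p \<and> u k \<ge> x"] i by (force simp: k_def[symmetric])
    then show ?thesis using k n[of i] i p by (intro exI[of _ k]) auto
  qed
qed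

section \<open>Assembly of the step sizes, the hitting result and the accumulation argument\<close>

theorem theorem2p1:
  "\<exists>\<alpha> :: nat \<Rightarrow> real.
     (\<forall>k. 0 < \<alpha> k) \<and> decseq \<alpha> \<and> \<alpha> \<in> o(\<lambda>k. 1 / ln (real k)) \<and>
     {-1..1} = crit_J \<and>
     (\<forall>(M :: 'w measure) (B :: nat \<Rightarrow> 'w \<Rightarrow> nat set).
        prob_space M \<longrightarrow>
        prob_space.indep_vars M (\<lambda>_. count_space batches) B UNIV \<longrightarrow>
        (\<forall>k. distr M (count_space batches) (B k) = uniform_count_measure batches) \<longrightarrow>
        (AE \<omega> in M.
           (\<forall>k. \<bar>iterates \<alpha> (\<lambda>k. B k \<omega>) k\<bar> \<le> 1) \<and>
           Acc (iterates \<alpha> (\<lambda>k. B k \<omega>)) = {-1..1}) \<and>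
        (AE \<omega> in M.
           \<not> convergent (iterates \<alpha> (\<lambda>k. B k \<omega>)) \<and>
           J constant_on Acc (iterates \<alpha> (\<lambda>k. B k \<omega>))))"
proof (rule exI[of _ step_size], intro conjI allI impI)
  show "0 < step_size k" for k by (rule step_size_pos)
  show "decseq step_size" by (rule decseq_step_size)
  show "step_size \<in> o(\<lambda>k. 1 / ln (real k))" by (rule step_size_smallo)
  show "{-1..1} = crit_J" by (simp add: crit_J_eq)
next
  fix M :: "'w measure" and B :: "nat \<Rightarrow> 'w \<Rightarrow> nat set"
  assume "prob_space M"
    and "prob_space.indep_vars M (\<lambda>_. count_space batches) B UNIV"
    and "\<forall>k. distr M (count_space batches) (B k) = uniform_count_measure batches"
  then interpret dyadic_walk step_exponent step_size M B
    by (intro dyadic_walk.intro iid_batches.intro dyadic_steps.intro iid_batches_axioms.intro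
        mono_step_exponent step_size_def) auto
  \<comment> \<open>The factors 1 and -1 are the two instances of \<open>s\<close>. Countably many
    starting times \<open>j\<close> allow one common null set.\<close>
  have "AE \<omega> in M. \<forall>j. (\<exists>k\<ge>j. 1 * w \<omega> k = 1) \<and> (\<exists>k\<ge>j. -1 * w \<omega> k = 1)"
    unfolding AE_all_countable
    by (intro allI AE_conjI AE_hits not_summable_step_size_square) auto
  then have main: "AE \<omega> in M. (\<forall>k. \<bar>w \<omega> k\<bar> \<le> 1) \<and> Acc (w \<omega>) = {-1..1}"
  proof (rule AE_mp, intro AE_I2 impI)
    fix \<omega> assume \<omega>: "\<omega> \<in> space M"
      and hits: "\<forall>j. (\<exists>k\<ge>j. 1 * w \<omega> k = 1) \<and> (\<exists>k\<ge>j. -1 * w \<omega> k = 1)"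
    have bound: "\<bar>w \<omega> k\<bar> \<le> 1" for k by (rule w_grid(2)[OF \<omega>])
    have "(\<lambda>k. w \<omega> (Suc k) - w \<omega> k) \<longlonglongrightarrow> 0"
    proof (rule Lim_null_comparison[OF always_eventually step_size_tendsto_0], rule allI)
      fix k
      have "w \<omega> (Suc k) = clip_step (step_size k) (w \<omega> k) (B k \<omega>)"
        using w_grid(3)[OF \<omega> B_in_batches[OF \<omega>]] by simp
      then show "norm (w \<omega> (Suc k) - w \<omega> k) \<le> step_size k"
        using clip_step_diff_le[OF bound step_size_pos] by (simp only: real_norm_def)
    qed
    moreover have "\<exists>k\<ge>j. w \<omega> k = -1" for j
    proof -
      obtain k where "k \<ge> j" "-1 * w \<omega> k = 1" using hits by blast
      then show ?thesis by (intro exI[of _ k]) linarith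
    qed
    moreover have "\<exists>k\<ge>j. w \<omega> k = 1" for j
      using hits unfolding mult_1 by blast
    ultimately have "{-1..1} \<subseteq> Acc (w \<omega>)"
      using Acc_oscillating by blast
    moreover have "Acc (w \<omega>) \<subseteq> {-1..1}"
    proof (rule Acc_closed_subset)
      show "w \<omega> k \<in> {-1..1}" for k
        using bound[of k] by (simp add: abs_le_iff minus_le_iff)
    qed simp
    ultimately show "(\<forall>k. \<bar>w \<omega> k\<bar> \<le> 1) \<and> Acc (w \<omega>) = {-1..1}"
      using bound by blast
  qed
  then show "AE \<omega> in M. (\<forall>k. \<bar>w \<omega> k\<bar> \<le> 1) \<and> Acc (w \<omega>) = {-1..1}" .
  \<comment> \<open>The linear terms of \<open>f1\<close> and \<open>f2\<close> cancel, and
    \<open>phi\<close> is 0 on the interval.\<close>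
  have "J constant_on {-1..1}"
    unfolding constant_on_def by (rule exI[of _ 0]) (auto simp: J_def f1_def f2_def phi_def)
  moreover have "\<not> convergent u" if "Acc u = {-1..1}" for u
    using convergent_Acc_eq[of u "-1" 1] that by auto
  ultimately show "AE \<omega> in M. \<not> convergent (w \<omega>) \<and> J constant_on Acc (w \<omega>)"
    using main by (elim AE_mp) (intro AE_I2, simp)
qed

end
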